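(* Let $d \ge 1$ and $N \ge 1$ be integers. Over integer (resp. rational) variables, the inductive separating polyhedral invariant problem for $N$ control states in dimension $d$ reduces to the inductive separating polyhedral invariant problem for $2$ control states in dimension $d+(N-1)$; that is, there is an algorithm mapping each instance of the first problem to an instance of the second problem such that the former has an inductive separating polyhedral invariant if and only if the latter does.
   Context: Let $K = \mathbb{Z}$ (integer variables) or $K = \mathbb{Q}$ (rational variables). Fix a language of arithmetic formulas that contains linear arithmetic (linear equalities and inequalities with rational coefficients) and is closed under Boolean combinations (for instance, Boolean combinations of linear, or of polynomial, equalities and inequalities); the same language is used for the transitions of both problems. A transition system with $M \ge 1$ control states in dimension $e$ has set of states $\{0,\dots,M-1\} \times K^e$; a state is written $\langle q, x_1,\dots,x_e\rangle$, where $q$ is the control state. Its initial state is $\langle 0,0,\dots,0\rangle$. The control state $M-1$ is the final "bad" state. Its transition relation $\tau$ is given by a formula over $(q,x_1,\dots,x_e,q',x'_1,\dots,x'_e)$ in the fixed language, in which the only atomic propositions involving $q$ or $q'$ are of the form $q = k$ or $q' = k$ with $0 \le k < M$ constant. In particular, a system with $2$ control states has one ordinary control state $0$ in addition to the bad state $1$. A convex polyhedron in $K^e$ is the set of points of $K^e$ satisfying a finite system of linear (affine) non-strict inequalities and equalities with rational coefficients; it may be empty or unbounded. The inductive separating polyhedral invariant problem for $M$ control states in dimension $e$: given such a transition system, decide whether there is a family $(P_q)_{0 \le q < M}$ of convex polyhedra in $K^e$ such that $(0,\dots,0) \in P_0$, $P_{M-1} = \emptyset$, and, whenever $x \in P_q$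 and there is a transition from $\langle q,x\rangle$ to $\langle q',x'\rangle$, one has $x' \in P_{q'}$. *)

theory Defs
  imports Complex_Main "HOL-Library.Nat_Bijection"
begin

section \<open>Arithmetic languages and transition formulas\<close>

text \<open>
  The domain of the variables is a set \<open>K\<close> of rationals, either \<open>\<int>\<close> or \<open>UNIV\<close>.
  Points of \<open>K\<^sup>e\<close> are lists of length \<open>e\<close>.
\<close>

definition points :: "rat set \<Rightarrow> nat \<Rightarrow> rat list set" where
  "points K e = {x. length x = e \<and> set x \<subseteq> K}"

text \<open>Coefficients beyond the end of the coefficient list count as zero.\<close>

definition lin :: "rat list \<Rightarrow> rat list \<Rightarrow> rat" where
  "lin a x = (\<Sum>i<length a. a ! i * x ! i)"

datatype rel = Le | Lt | Eq

fun rel_holds :: "rel \<Rightarrow> rat \<Rightarrow> rat \<Rightarrow> bool" where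
  "rel_holds Le s t \<longleftrightarrow> s \<le> t"
| "rel_holds Lt s t \<longleftrightarrow> s < t"
| "rel_holds Eq s t \<longleftrightarrow> s = t"

text \<open>
  Besides linear arithmetic, which is always present, a language may provide further arithmetic
  formulas over the unprimed and primed numerical variables (polynomial constraints, say). These
  are given by the set of their Goedel numbers and by an arbitrary semantics. Formula \<open>c\<close> speaks
  only about the first \<open>arity L c\<close> unprimed and the first \<open>arity L c\<close> primed variables, which are
  the two arguments of \<open>sat L c\<close>.
\<close>

record arith_lang =
  extra :: "nat set"
  arity :: "nat \<Rightarrow> nat"
  sat :: "nat \<Rightarrow> rat list \<Rightarrow> rat list \<Rightarrow> bool"

text \<open>
  \<open>Lin r a a' b\<close> is the constraint \<open>a \<cdot> x + a' \<cdot> x' r b\<close>; \<open>Cur k\<close> and \<open>Nxt k\<close> are the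
  control-state atoms \<open>q = k\<close> and \<open>q' = k\<close>.
\<close>

datatype fm =
    Lin rel "rat list" "rat list" rat
  | Ext nat
  | Cur nat
  | Nxt nat
  | Neg fm
  | Conj fm fm
  | Disj fm fm

fun holds :: "arith_lang \<Rightarrow> fm \<Rightarrow> nat \<Rightarrow> rat list \<Rightarrow> nat \<Rightarrow> rat list \<Rightarrow> bool" where
  "holds L (Lin r a a' b) q x q' x' \<longleftrightarrow> rel_holds r (lin a x + lin a' x') b"
| "holds L (Ext c) q x q' x' \<longleftrightarrow> sat L c (take (arity L c) x) (take (arity L c) x')"
| "holds L (Cur k) q x q' x' \<longleftrightarrow> q = k"
| "holds L (Nxt k) q x q' x' \<longleftrightarrow> q' = k"
| "holds L (Neg \<phi>) q x q' x' \<longleftrightarrow> \<not> holds L \<phi> q x q' x'"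
| "holds L (Conj \<phi> \<psi>) q x q' x' \<longleftrightarrow> holds L \<phi> q x q' x' \<and> holds L \<psi> q x q' x'"
| "holds L (Disj \<phi> \<psi>) q x q' x' \<longleftrightarrow> holds L \<phi> q x q' x' \<or> holds L \<psi> q x q' x'"

text \<open>The formulas that define a transition system with \<open>M\<close> control states in dimension \<open>e\<close>.\<close>

fun wf_fm :: "arith_lang \<Rightarrow> nat \<Rightarrow> nat \<Rightarrow> fm \<Rightarrow> bool" where
  "wf_fm L M e (Lin r a a' b) \<longleftrightarrow> length a \<le> e \<and> length a' \<le> e"
| "wf_fm L M e (Ext c) \<longleftrightarrow> c \<in> extra L \<and> arity L c \<le> e"
| "wf_fm L M e (Cur k) \<longleftrightarrow> k < M"
| "wf_fm L M e (Nxt k) \<longleftrightarrow> k < M"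
| "wf_fm L M e (Neg \<phi>) \<longleftrightarrow> wf_fm L M e \<phi>"
| "wf_fm L M e (Conj \<phi> \<psi>) \<longleftrightarrow> wf_fm L M e \<phi> \<and> wf_fm L M e \<psi>"
| "wf_fm L M e (Disj \<phi> \<psi>) \<longleftrightarrow> wf_fm L M e \<phi> \<and> wf_fm L M e \<psi>"

definition instances :: "arith_lang \<Rightarrow> nat \<Rightarrow> nat \<Rightarrow> fm set" where
  "instances L M e = {\<phi>. wf_fm L M e \<phi>}"

definition states :: "rat set \<Rightarrow> nat \<Rightarrow> nat \<Rightarrow> (nat \<times> rat list) set" where
  "states K M e = {..<M} \<times> points K e"

definition transitions ::
  "rat set \<Rightarrow> arith_lang \<Rightarrow> nat \<Rightarrow> nat \<Rightarrow> fm \<Rightarrow> ((nat \<times> rat list) \<times> (nat \<times> rat list)) set" where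
  "transitions K L M e \<phi> =
     {((q, x), (q', x')) | q x q' x'.
        (q, x) \<in> states K M e \<and> (q', x') \<in> states K M e \<and> holds L \<phi> q x q' x'}"


section \<open>Inductive separating polyhedral invariants\<close>

text \<open>The sets \<open>I\<close> and \<open>E\<close> hold the inequalities \<open>a \<cdot> x \<le> b\<close> and the equalities \<open>a \<cdot> x = b\<close>.\<close>

definition convex_polyhedron :: "rat set \<Rightarrow> nat \<Rightarrow> rat list set \<Rightarrow> bool" where
  "convex_polyhedron K e P \<longleftrightarrow>
     (\<exists>I E. finite I \<and> finite E \<and> (\<forall>(a, b) \<in> I \<union> E. length a = e) \<and>
        P = {x \<in> points K e. (\<forall>(a, b) \<in> I. lin a x \<le> b) \<and> (\<forall>(a, b) \<in> E. lin a x = b)})"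

definition separating_invariant ::
  "rat set \<Rightarrow> arith_lang \<Rightarrow> nat \<Rightarrow> nat \<Rightarrow> fm \<Rightarrow> (nat \<Rightarrow> rat list set) \<Rightarrow> bool" where
  "separating_invariant K L M e \<phi> P \<longleftrightarrow>
     (\<forall>q<M. convex_polyhedron K e (P q)) \<and>
     replicate e 0 \<in> P 0 \<and>
     P (M - 1) = {} \<and>
     (\<forall>q x q' x'. x \<in> P q \<longrightarrow> ((q, x), (q', x')) \<in> transitions K L M e \<phi> \<longrightarrow> x' \<in> P q')"

definition has_separating_invariant ::
  "rat set \<Rightarrow> arith_lang \<Rightarrow> nat \<Rightarrow> nat \<Rightarrow> fm \<Rightarrow> bool" where
  "has_separating_invariant K L M e \<phi> \<longleftrightarrow> (\<exists>P. separating_invariant K L M e \<phi> P)"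


section \<open>Algorithms\<close>

text \<open>
  Algorithms are Kleene's partial recursive functions. \<open>rec_eval f xs y\<close> says that \<open>f\<close> terminates
  on the arguments \<open>xs\<close> with result \<open>y\<close>.
\<close>

datatype recf =
    Zero
  | Succ
  | Proj nat
  | Comp recf "recf list"
  | PrimRec recf recf
  | Minimize recf

inductive rec_eval :: "recf \<Rightarrow> nat list \<Rightarrow> nat \<Rightarrow> bool" where
  zero: "rec_eval Zero xs 0"
| succ: "rec_eval Succ [x] (Suc x)"
| proj: "i < length xs \<Longrightarrow> rec_eval (Proj i) xs (xs ! i)"
| comp: "list_all2 (\<lambda>g y. rec_eval g xs y) gs ys \<Longrightarrow> rec_eval f ys z \<Longrightarrow>
    rec_eval (Comp f gs) xs z"
| primrec_0: "rec_eval f xs y \<Longrightarrow> rec_eval (PrimRec f g) (0 # xs) y"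
| primrec_Suc: "rec_eval (PrimRec f g) (n # xs) y \<Longrightarrow> rec_eval g (n # y # xs) z \<Longrightarrow>
    rec_eval (PrimRec f g) (Suc n # xs) z"
| minimize: "rec_eval f (n # xs) 0 \<Longrightarrow> (\<forall>m<n. \<exists>k. rec_eval f (m # xs) (Suc k)) \<Longrightarrow>
    rec_eval (Minimize f) xs n"

lemma rec_eval_deterministic:
  "rec_eval f xs y \<Longrightarrow> rec_eval f xs z \<Longrightarrow> y = z"
proof (induction arbitrary: z rule: rec_eval.induct)
  case (zero xs)
  then show ?case by cases simp
next
  case (succ x)
  then show ?case by cases simp
next
  case (proj i xs)
  from proj.prems show ?case by cases simp
next
  case (comp xs gs ys f w)
  from comp.prems obtain ys' where
    ys': "list_all2 (\<lambda>g y. rec_eval g xs y) gs ys'" "rec_eval f ys' z"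
    by cases blast
  have "ys = ys'"
    using comp.IH(1) ys'(1) by (auto simp: list_all2_conv_all_nth intro!: nth_equalityI)
  then show ?case using comp.IH(2) ys'(2) by blast
next
  case (primrec_0 f xs y g)
  from primrec_0.prems show ?case by cases (rule primrec_0.IH)
next
  case (primrec_Suc f g n xs y w)
  from primrec_Suc.prems obtain y' where
    "rec_eval (PrimRec f g) (n # xs) y'" "rec_eval g (n # y' # xs) z"
    by cases blast
  then show ?case using primrec_Suc.IH by blast
next
  case (minimize f n xs)
  from minimize.prems have z: "rec_eval f (z # xs) 0" "\<forall>m<z. \<exists>k. rec_eval f (m # xs) (Suc k)"
    by (cases; blast)+
  show ?case
  proof (rule linorder_cases[of n z])
    assume "n < z"
    with z(2) obtain k where "rec_eval f (n # xs) (Suc k)" by blast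
    from minimize.IH(1)[OF this] show ?thesis by simp
  next
    assume "z < n"
    with minimize.IH(2) z(1) show ?thesis by blast
  qed
qed

text \<open>
  Formulas are coded by their Polish (prefix) notation, a word over the natural numbers; each
  symbol is tagged with its kind.
\<close>

fun rel_code :: "rel \<Rightarrow> nat" where
  "rel_code Le = 0"
| "rel_code Lt = 1"
| "rel_code Eq = 2"

definition rat_code :: "rat \<Rightarrow> nat" where
  "rat_code r = prod_encode (int_encode (fst (quotient_of r)), int_encode (snd (quotient_of r)))"

definition lin_code :: "rel \<Rightarrow> rat list \<Rightarrow> rat list \<Rightarrow> rat \<Rightarrow> nat" where
  "lin_code r a a' b = list_encode
     [rel_code r, list_encode (map rat_code a), list_encode (map rat_code a'), rat_code b]"

fun polish :: "fm \<Rightarrow> nat list" where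
  "polish (Lin r a a' b) = [prod_encode (0, lin_code r a a' b)]"
| "polish (Ext c) = [prod_encode (1, c)]"
| "polish (Cur k) = [prod_encode (2, k)]"
| "polish (Nxt k) = [prod_encode (3, k)]"
| "polish (Neg \<phi>) = prod_encode (4, 0) # polish \<phi>"
| "polish (Conj \<phi> \<psi>) = prod_encode (5, 0) # polish \<phi> @ polish \<psi>"
| "polish (Disj \<phi> \<psi>) = prod_encode (6, 0) # polish \<phi> @ polish \<psi>"

definition fm_code :: "fm \<Rightarrow> nat" where
  "fm_code \<phi> = list_encode (polish \<phi>)"

lemma rel_code_inject: "rel_code r = rel_code s \<longleftrightarrow> r = s"
  by (cases r; cases s) auto

lemma rat_code_inject: "rat_code r = rat_code s \<longleftrightarrow> r = s"
  by (simp add: rat_code_def prod_eq_iff int_encode_eq flip: quotient_of_inject_eq)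

lemma lin_code_inject:
  "lin_code r a a' b = lin_code s c c' d \<longleftrightarrow> r = s \<and> a = c \<and> a' = c' \<and> b = d"
proof -
  have "inj rat_code"
    by (simp add: inj_def rat_code_inject)
  then show ?thesis
    by (simp add: lin_code_def rel_code_inject rat_code_inject list_encode_eq inj_map_eq_map)
qed

lemma polish_append_inject: "polish \<phi> @ u = polish \<psi> @ v \<Longrightarrow> \<phi> = \<psi> \<and> u = v"
proof (induction \<phi> arbitrary: \<psi> u v)
  case (Lin r a a' b)
  then show ?case by (cases \<psi>) (simp_all add: lin_code_inject)
next
  case (Ext c)
  then show ?case by (cases \<psi>) simp_all
next
  case (Cur k)
  then show ?case by (cases \<psi>) simp_all
next
  case (Nxt k)
  then show ?case by (cases \<psi>) simp_all
next
  case (Neg \<phi>)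
  then show ?case by (cases \<psi>) auto
next
  case (Conj \<phi>1 \<phi>2)
  from Conj.prems obtain \<psi>1 \<psi>2 where \<psi>: "\<psi> = Conj \<psi>1 \<psi>2" by (cases \<psi>) simp_all
  with Conj.prems have eq: "polish \<phi>1 @ (polish \<phi>2 @ u) = polish \<psi>1 @ (polish \<psi>2 @ v)" by simp
  from Conj.IH(1)[OF eq] Conj.IH(2) \<psi> show ?case by blast
next
  case (Disj \<phi>1 \<phi>2)
  from Disj.prems obtain \<psi>1 \<psi>2 where \<psi>: "\<psi> = Disj \<psi>1 \<psi>2" by (cases \<psi>) simp_all
  with Disj.prems have eq: "polish \<phi>1 @ (polish \<phi>2 @ u) = polish \<psi>1 @ (polish \<psi>2 @ v)" by simp
  from Disj.IH(1)[OF eq] Disj.IH(2) \<psi> show ?case by blast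
qed

lemma inj_fm_code: "inj fm_code"
  using polish_append_inject[of _ "[]" _ "[]"] by (auto simp: inj_def fm_code_def list_encode_eq)

definition computable_on :: "fm set \<Rightarrow> (fm \<Rightarrow> fm) \<Rightarrow> bool" where
  "computable_on S F \<longleftrightarrow> (\<exists>r. \<forall>\<phi>\<in>S. rec_eval r [fm_code \<phi>] (fm_code (F \<phi>)))"

end

theory Submission
  imports Defs
begin

text \<open>
  If the control states were coded by fixed points in the new dimensions, a polyhedron that contains
  the codes of \<open>P\<^sub>0\<close> and \<open>P\<^sub>1\<close> would also contain all translates of either slice along the unbounded
  directions of the other. Therefore the code of a point \<open>x\<close> carries a scale \<open>t\<close>, any number with
  \<open>\<bar>x\<^sub>i\<bar> \<le> t\<close> for all \<open>i\<close>, and control state \<open>q\<close> is coded by the vertex \<open>q\<close> of a simplex multiplied by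
  \<open>1 + t\<close>. There is an affine function \<open>f\<^sub>q\<close> that is \<open>0\<close> on the codes of state \<open>q\<close> and \<open>1 + t\<close> on all
  other codes; hence for large \<open>c\<close> the inequality \<open>a \<cdot> x - c f\<^sub>q \<le> b\<close> says \<open>a \<cdot> x \<le> b\<close> in state \<open>q\<close> and
  nothing elsewhere, and the inequalities of all \<open>P\<^sub>q\<close>, so relaxed, define a single invariant.
  Conversely, the points whose codes at all sufficiently large scales lie in a given polyhedron form
  a polyhedron: only the signs of the coefficients of \<open>t\<close>, and the inequalities in which \<open>t\<close> does not
  occur, matter. This avoids projecting \<open>t\<close> away, which would fail over the integers.
\<close>

section \<open>Total recursive functions\<close>

text \<open>Only argument lists of length \<open>k\<close> matter, so closure properties can be
  stated for ordinary functions without naming terms of type \<open>recf\<close>.\<close>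

definition total_rec :: "nat \<Rightarrow> (nat list \<Rightarrow> nat) \<Rightarrow> bool" where
  "total_rec k f \<longleftrightarrow> (\<exists>r. \<forall>xs. length xs = k \<longrightarrow> rec_eval r xs (f xs))"

lemma total_rec_cong:
  assumes "total_rec k f" "\<And>xs. length xs = k \<Longrightarrow> f xs = g xs"
  shows "total_rec k g"
  using assms unfolding total_rec_def by force

lemma total_rec_zero: "total_rec k (\<lambda>_. 0)"
  unfolding total_rec_def using rec_eval.zero by blast

lemma total_rec_proj: "i < k \<Longrightarrow> total_rec k (\<lambda>xs. xs ! i)"
  unfolding total_rec_def using rec_eval.proj by blast

lemma total_rec_comp:
  assumes "total_rec (length gs) f" "\<And>g. g \<in> set gs \<Longrightarrow> total_rec k g"
  shows "total_rec k (\<lambda>xs. f (map (\<lambda>g. g xs) gs))"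
proof -
  obtain r where r: "\<And>xs. length xs = length gs \<Longrightarrow> rec_eval r xs (f xs)"
    using assms(1) unfolding total_rec_def by blast
  have "\<forall>g\<in>set gs. \<exists>r. \<forall>xs. length xs = k \<longrightarrow> rec_eval r xs (g xs)"
    using assms(2) unfolding total_rec_def by blast
  then obtain R where R: "\<And>g xs. g \<in> set gs \<Longrightarrow> length xs = k \<Longrightarrow> rec_eval (R g) xs (g xs)"
    by metis
  have "rec_eval (Comp r (map R gs)) xs (f (map (\<lambda>g. g xs) gs))" if "length xs = k" for xs
    by (rule rec_eval.comp[where ys = "map (\<lambda>g. g xs) gs"])
      (auto simp: list_all2_conv_all_nth R r that)
  then show ?thesis unfolding total_rec_def by blast
qed

lemma total_rec_comp1:
  assumes "total_rec 1 (\<lambda>xs. f (xs ! 0))" "total_rec k g"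
  shows "total_rec k (\<lambda>xs. f (g xs))"
  using total_rec_comp[of "[g]" "\<lambda>xs. f (xs ! 0)" k] assms by simp

lemma total_rec_comp2:
  assumes "total_rec 2 (\<lambda>xs. f (xs ! 0) (xs ! 1))" "total_rec k g" "total_rec k h"
  shows "total_rec k (\<lambda>xs. f (g xs) (h xs))"
  using total_rec_comp[of "[g, h]" "\<lambda>xs. f (xs ! 0) (xs ! 1)" k] assms
  by (auto simp: numeral_2_eq_2)

lemma total_rec_comp3:
  assumes "total_rec 3 (\<lambda>xs. f (xs ! 0) (xs ! 1) (xs ! 2))"
    and "total_rec k g" "total_rec k h" "total_rec k i"
  shows "total_rec k (\<lambda>xs. f (g xs) (h xs) (i xs))"
  using total_rec_comp[of "[g, h, i]" "\<lambda>xs. f (xs ! 0) (xs ! 1) (xs ! 2)" k] assms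
  by (auto simp: numeral_3_eq_3 numeral_2_eq_2)

lemma total_rec_Suc:
  assumes "total_rec k f"
  shows "total_rec k (\<lambda>xs. Suc (f xs))"
proof -
  have "rec_eval Succ xs (Suc (xs ! 0))" if "length xs = 1" for xs
    using that rec_eval.succ[of "xs ! 0"] by (auto simp: length_Suc_conv)
  then have "total_rec 1 (\<lambda>xs. Suc (xs ! 0))"
    unfolding total_rec_def by blast
  from total_rec_comp1[OF this assms] show ?thesis .
qed

lemma total_rec_const: "total_rec k (\<lambda>_. c)"
  by (induction c) (simp_all add: total_rec_zero total_rec_Suc)

lemma total_rec_primrec:
  assumes "total_rec k b" "total_rec (Suc (Suc k)) g"
  shows "total_rec (Suc k) (\<lambda>xs. rec_nat (b (tl xs)) (\<lambda>n y. g (n # y # tl xs)) (hd xs))"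
proof -
  obtain r where r: "\<And>xs. length xs = k \<Longrightarrow> rec_eval r xs (b xs)"
    using assms(1) unfolding total_rec_def by blast
  obtain s where s: "\<And>xs. length xs = Suc (Suc k) \<Longrightarrow> rec_eval s xs (g xs)"
    using assms(2) unfolding total_rec_def by blast
  have *: "rec_eval (PrimRec r s) (m # ys) (rec_nat (b ys) (\<lambda>n y. g (n # y # ys)) m)"
    if "length ys = k" for m ys
    using that by (induction m) (auto intro!: rec_eval.intros r s)
  have "rec_eval (PrimRec r s) xs (rec_nat (b (tl xs)) (\<lambda>n y. g (n # y # tl xs)) (hd xs))"
    if "length xs = Suc k" for xs
    using that *[of "tl xs" "hd xs"] by (cases xs) auto
  then show ?thesis unfolding total_rec_def by blast
qed

lemma total_rec_primrec2:
  assumes "total_rec 1 (\<lambda>xs. b (xs ! 0))" "total_rec 3 (\<lambda>xs. g (xs ! 0) (xs ! 1) (xs ! 2))"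
    and "\<And>x. f 0 x = b x" "\<And>n x. f (Suc n) x = g n (f n x) x"
  shows "total_rec 2 (\<lambda>xs. f (xs ! 0) (xs ! 1))"
proof -
  have "rec_nat (b x) (\<lambda>n y. g n y x) m = f m x" for m x
    by (induction m) (simp_all add: assms)
  then show ?thesis
    using total_rec_primrec[of 1 "\<lambda>xs. b (xs ! 0)" "\<lambda>xs. g (xs ! 0) (xs ! 1) (xs ! 2)"] assms(1,2)
    by (auto simp: numeral_2_eq_2 numeral_3_eq_3 length_Suc_conv elim!: total_rec_cong)
qed

lemma total_rec_Least:
  assumes "total_rec (Suc k) f" "\<And>xs. length xs = k \<Longrightarrow> \<exists>n. f (n # xs) = 0"
  shows "total_rec k (\<lambda>xs. LEAST n. f (n # xs) = 0)"
proof -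
  obtain r where r: "\<And>xs. length xs = Suc k \<Longrightarrow> rec_eval r xs (f xs)"
    using assms(1) unfolding total_rec_def by blast
  have "rec_eval (Minimize r) xs (LEAST n. f (n # xs) = 0)" if len: "length xs = k" for xs
  proof (rule rec_eval.minimize)
    have "f ((LEAST n. f (n # xs) = 0) # xs) = 0"
      using assms(2)[OF len] by (rule LeastI_ex)
    then show "rec_eval r ((LEAST n. f (n # xs) = 0) # xs) 0"
      using r[of "(LEAST n. f (n # xs) = 0) # xs"] len by simp
    show "\<forall>m<(LEAST n. f (n # xs) = 0). \<exists>j. rec_eval r (m # xs) (Suc j)"
    proof (intro allI impI)
      fix m assume "m < (LEAST n. f (n # xs) = 0)"
      then have "f (m # xs) \<noteq> 0" by (rule not_less_Least)
      then show "\<exists>j. rec_eval r (m # xs) (Suc j)"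
        using r[of "m # xs"] len by (metis length_Cons not0_implies_Suc)
    qed
  qed
  then show ?thesis unfolding total_rec_def by blast
qed

section \<open>Recursiveness of arithmetic and of the pairing function\<close>

lemma total_rec_plus:
  assumes "total_rec k f" "total_rec k g"
  shows "total_rec k (\<lambda>xs. f xs + g xs)"
proof (rule total_rec_comp2[OF _ assms])
  show "total_rec 2 (\<lambda>xs. xs ! 0 + xs ! 1)"
    by (rule total_rec_primrec2[where b = "\<lambda>x. x" and g = "\<lambda>n y x. Suc y"])
      (auto intro!: total_rec_proj total_rec_Suc)
qed

lemma total_rec_minus:
  assumes "total_rec k f" "total_rec k g"
  shows "total_rec k (\<lambda>xs. f xs - g xs)"
proof -
  have "total_rec 2 (\<lambda>xs. (\<lambda>n (x::nat). n - 1) (xs ! 0) (xs ! 1))"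
    by (rule total_rec_primrec2[where b = "\<lambda>x. 0" and g = "\<lambda>n y x. n"])
      (auto intro!: total_rec_proj total_rec_zero)
  from total_rec_comp2[OF this] have pred: "total_rec j h \<Longrightarrow> total_rec j (\<lambda>xs. h xs - 1)" for j h
    by blast
  \<comment> \<open>The predecessor is iterated along the subtrahend, which therefore comes
    first.\<close>
  have "total_rec 2 (\<lambda>xs. (\<lambda>n x. x - n) (xs ! 0) (xs ! 1))"
    by (rule total_rec_primrec2[where b = "\<lambda>x. x" and g = "\<lambda>n y x. y - 1"])
      (auto intro!: total_rec_proj pred simp del: One_nat_def)
  from total_rec_comp2[OF this assms(2,1)] show ?thesis .
qed

lemma total_rec_triangle:
  assumes "total_rec k f"
  shows "total_rec k (\<lambda>xs. triangle (f xs))"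
proof -
  have "total_rec 2 (\<lambda>xs. (\<lambda>n (x::nat). triangle n) (xs ! 0) (xs ! 1))"
    by (rule total_rec_primrec2[where b = "\<lambda>x. 0" and g = "\<lambda>n y x. y + Suc n"])
      (auto intro!: total_rec_proj total_rec_zero total_rec_plus total_rec_Suc
        simp del: add_Suc_right)
  from total_rec_comp2[OF this assms assms] show ?thesis .
qed

lemma total_rec_prod_encode:
  assumes "total_rec k f" "total_rec k g"
  shows "total_rec k (\<lambda>xs. prod_encode (f xs, g xs))"
  unfolding prod_encode_def prod.case
  by (intro total_rec_plus total_rec_triangle assms)

lemma total_rec_if_zero:
  assumes "total_rec k c" "total_rec k f" "total_rec k g"
  shows "total_rec k (\<lambda>xs. if c xs = 0 then f xs else g xs)"
proof (rule total_rec_comp3[where f = "\<lambda>c x y. if c = 0 then x else y", OF _ assms])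
  have "rec_nat x (\<lambda>n z. y) m = (if m = 0 then x else y)" for m and x y :: nat
    by (cases m) simp_all
  then show "total_rec 3 (\<lambda>xs. if xs ! 0 = 0 then xs ! 1 else xs ! 2)"
    \<comment> \<open>The step receives the counter, the previous value and the two branches, so
      index 3 is the nonzero branch.\<close>
    using total_rec_primrec[of 2 "\<lambda>xs. xs ! 0" "\<lambda>xs. xs ! 3"]
    by (auto simp: numeral_2_eq_2 numeral_3_eq_3 length_Suc_conv total_rec_proj
        elim!: total_rec_cong)
qed

text \<open>Since z = triangle (m + n) + m and m <= m + n, the diagonal m + n is the least s with z
  < triangle (s + 1), so an unbounded search inverts the pairing. Truncated subtraction expresses
  the comparison.\<close>

lemma prod_decode_Least:
  fixes z :: nat
  defines "s \<equiv> LEAST s. Suc z - triangle (Suc s) = 0"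
  shows "fst (prod_decode z) = z - triangle s" "snd (prod_decode z) = s - (z - triangle s)"
proof -
  obtain m n where mn: "prod_decode z = (m, n)" by fastforce
  then have z: "z = triangle (m + n) + m"
    using prod_decode_inverse[of z] by (simp add: prod_encode_def)
  have mono: "triangle a \<le> triangle b" if "a \<le> b" for a b
    using that by (induction rule: dec_induct) auto
  have "s = m + n"
    unfolding s_def
  proof (rule Least_equality)
    show "Suc z - triangle (Suc (m + n)) = 0" by (simp add: z)
    show "m + n \<le> y" if "Suc z - triangle (Suc y) = 0" for y
    proof (rule ccontr)
      assume "\<not> m + n \<le> y"
      then have "triangle (Suc y) \<le> triangle (m + n)" by (intro mono) simp
      with that show False by (simp add: z)
    qed
  qed
  then show "fst (prod_decode z) = z - triangle s" "snd (prod_decode z) = s - (z - triangle s)"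
    by (simp_all only: mn fst_conv snd_conv) (simp_all add: z)
qed

lemma total_rec_prod_decode:
  assumes "total_rec k f"
  shows total_rec_fst: "total_rec k (\<lambda>xs. fst (prod_decode (f xs)))"
    and total_rec_snd: "total_rec k (\<lambda>xs. snd (prod_decode (f xs)))"
proof -
  have ex: "\<exists>s. z \<le> triangle s + s" for z
    by (rule exI[of _ z]) simp
  have "total_rec (Suc 1) (\<lambda>xs. Suc (xs ! 1) - triangle (Suc (xs ! 0)))"
    by (intro total_rec_minus total_rec_triangle total_rec_Suc total_rec_proj) auto
  from total_rec_Least[OF this] have
    "total_rec 1 (\<lambda>xs. LEAST s. Suc (xs ! 0) - triangle (Suc s) = 0)"
    using ex by simp
  note least = total_rec_comp1[OF this assms]
  show "total_rec k (\<lambda>xs. fst (prod_decode (f xs)))" "total_rec k (\<lambda>xs. snd (prod_decode (f xs)))"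
    unfolding prod_decode_Least by (intro total_rec_minus total_rec_triangle least assms)+
qed

text \<open>A table of the finitely many exceptions suffices, so the way \<open>s\<close> acts on
  them never has to be computed.\<close>

lemma total_rec_finite_change:
  assumes "finite {z. s z \<noteq> z}"
  shows "total_rec 1 (\<lambda>xs. s (xs ! 0))"
proof -
  have "total_rec 1 (\<lambda>xs. s (xs ! 0))" if "finite A" "{z. s z \<noteq> z} \<subseteq> A" for A s
    using that
  proof (induction A arbitrary: s rule: finite_induct)
    case empty
    then have "s = (\<lambda>z. z)" by auto
    then show ?case by (simp add: total_rec_proj)
  next
    case (insert a A)
    let ?s = "s(a := a)"
    have "total_rec 1 (\<lambda>xs. ?s (xs ! 0))"
      using insert.prems by (intro insert.IH) auto
    \<comment> \<open>The two truncated differences sum to 0 exactly when the argument is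
      \<open>a\<close>.\<close>
    then have "total_rec 1 (\<lambda>xs. if (xs ! 0 - a) + (a - xs ! 0) = 0 then s a else ?s (xs ! 0))"
      by (intro total_rec_if_zero total_rec_plus total_rec_minus total_rec_proj total_rec_const) auto
    then show ?case by (rule total_rec_cong) auto
  qed
  with assms show ?thesis by blast
qed

text \<open>
  The result is built from the right end of the list: the \<open>i\<close>-th stage of the loop handles the
  suffix that is left after \<open>c - i\<close> elements are dropped, where \<open>c\<close>, the code of the list, is a
  bound on its length.
\<close>

lemma total_rec_map:
  assumes "total_rec 1 (\<lambda>xs. s (xs ! 0))"
  shows "total_rec 1 (\<lambda>xs. list_encode (map s (list_decode (xs ! 0))))"
proof -
  \<comment> \<open>The empty list has code 0 and any other list the successor of a pair, so
    \<open>ct\<close> gives the code of the tail. It fixes 0, because 0 - 1 = 0 and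
    \<open>prod_decode 0 = (0, 0)\<close>.\<close>
  define ct where "ct c = snd (prod_decode (c - 1))" for c
  define D where "D i c = (ct ^^ i) c" for i c
  define M where "M = (\<lambda>i c. rec_nat 0 (\<lambda>i y. if D (c - Suc i) c = 0 then y else
    Suc (prod_encode (s (fst (prod_decode (D (c - Suc i) c - 1))), y))) i)"
  have ct_Cons: "ct (list_encode w) = list_encode (tl w)" for w
  proof (cases w)
    case Nil
    have "prod_decode 0 = (0, 0)" by (simp add: prod_decode_def prod_decode_aux.simps)
    with Nil show ?thesis by (simp add: ct_def)
  qed (simp add: ct_def)
  have D: "D i (list_encode w) = list_encode (drop i w)" for i w
    by (induction i) (simp_all add: D_def ct_Cons drop_Suc tl_drop)
  have le: "length w \<le> list_encode w" for w
  proof (induction w)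
    case (Cons a w)
    then show ?case using le_prod_encode_2[of "list_encode w" a] by simp
  qed simp
  have M: "M i c = list_encode (map s (drop (c - i) w))" if "i \<le> c" "c = list_encode w" for i c w
    using that
  proof (induction i)
    case 0
    then show ?case using le[of w] by (simp add: M_def)
  next
    case (Suc i)
    have step: "c - i = Suc (c - Suc i)" using Suc.prems(1) by simp
    have "drop (c - i) w = tl (drop (c - Suc i) w)"
      by (simp only: step drop_Suc tl_drop)
    then show ?case
      using Suc by (cases "drop (c - Suc i) w") (simp_all add: M_def D)
  qed
  have ct_rec: "total_rec k f \<Longrightarrow> total_rec k (\<lambda>xs. ct (f xs))" for k f
    unfolding ct_def by (intro total_rec_snd total_rec_minus total_rec_const)
  have "total_rec 2 (\<lambda>xs. D (xs ! 0) (xs ! 1))"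
    by (rule total_rec_primrec2[where b = "\<lambda>x. x" and g = "\<lambda>n y x. ct y"])
      (auto intro!: ct_rec total_rec_proj simp: D_def)
  note D_rec = total_rec_comp2[OF this]
  have "total_rec 2 (\<lambda>xs. M (xs ! 0) (xs ! 1))"
  proof (rule total_rec_primrec2[where b = "\<lambda>x. 0" and
        g = "\<lambda>n y x. if D (x - Suc n) x = 0 then y else
          Suc (prod_encode (s (fst (prod_decode (D (x - Suc n) x - 1))), y))"])
    show "total_rec 3 (\<lambda>xs. if D (xs ! 2 - Suc (xs ! 0)) (xs ! 2) = 0 then xs ! 1 else
      Suc (prod_encode (s (fst (prod_decode (D (xs ! 2 - Suc (xs ! 0)) (xs ! 2) - 1))), xs ! 1)))"
      by (intro total_rec_if_zero D_rec total_rec_Suc total_rec_minus total_rec_prod_encode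
          total_rec_fst total_rec_const total_rec_comp1[OF assms] total_rec_proj) simp_all
  qed (simp_all add: total_rec_zero M_def)
  from total_rec_comp2[OF this, of 1 "\<lambda>xs. xs ! 0" "\<lambda>xs. xs ! 0"]
  have "total_rec 1 (\<lambda>xs. M (xs ! 0) (xs ! 0))"
    by (simp add: total_rec_proj)
  moreover have "M c c = list_encode (map s (list_decode c))" for c
    using M[of c c "list_decode c"] by simp
  ultimately show ?thesis by simp
qed

lemma total_rec_append:
  assumes "total_rec k (\<lambda>xs. list_encode (f xs))"
  shows "total_rec k (\<lambda>xs. list_encode (u @ f xs))"
  by (induction u) (simp_all add: assms total_rec_Suc total_rec_prod_encode total_rec_const)

lemma computable_onI:
  assumes "total_rec 1 (\<lambda>xs. list_encode (h (list_decode (xs ! 0))))"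
    and "\<And>\<phi>. \<phi> \<in> S \<Longrightarrow> polish (F \<phi>) = h (polish \<phi>)"
  shows "computable_on S F"
proof -
  obtain r where r: "\<And>xs. length xs = 1 \<Longrightarrow> rec_eval r xs (list_encode (h (list_decode (xs ! 0))))"
    using assms(1) unfolding total_rec_def by blast
  have "rec_eval r [fm_code \<phi>] (fm_code (F \<phi>))" if "\<phi> \<in> S" for \<phi>
    using r[of "[fm_code \<phi>]"] assms(2)[OF that] by (simp add: fm_code_def)
  then show ?thesis unfolding computable_on_def by blast
qed

section \<open>Linear forms and polyhedra\<close>

lemma lin_Nil [simp]: "lin [] x = 0"
  by (simp add: lin_def)

lemma lin_Cons [simp]: "lin (a # as) (x # xs) = a * x + lin as xs"
  by (simp add: lin_def sum.lessThan_Suc_shift del: sum.lessThan_Suc)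

lemma lin_append: "length a = length x \<Longrightarrow> lin (a @ b) (x @ y) = lin a x + lin b y"
proof (induction a arbitrary: x)
  case (Cons c a)
  then show ?case by (cases x) auto
qed simp

lemma lin_map: "lin (map f [0..<m]) x = (\<Sum>j<m. f j * x ! j)"
  by (simp add: lin_def)

lemma lin_map_uminus: "lin (map uminus a) x = - lin a x"
  by (simp add: lin_def sum_negf)

lemma lin_replicate_zero [simp]: "lin (replicate m 0) x = 0"
  by (simp add: lin_def)

text \<open>Hoelder's inequality for the 1-norm of \<open>a\<close> and the maximum norm of
  \<open>x\<close>; later \<open>t\<close> is the scale of a code.\<close>

lemma abs_lin_le:
  assumes "length a = length x" "\<And>i. i < length x \<Longrightarrow> \<bar>x ! i\<bar> \<le> t"
  shows "\<bar>lin a x\<bar> \<le> (\<Sum>c\<leftarrow>a. \<bar>c\<bar>) * t"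
proof -
  have "\<bar>lin a x\<bar> \<le> (\<Sum>i<length a. \<bar>a ! i\<bar> * t)"
    unfolding lin_def using assms
    by (intro order_trans[OF sum_abs] sum_mono) (auto simp: abs_mult intro!: mult_left_mono)
  then show ?thesis
    by (simp add: sum_list_sum_nth sum_distrib_right atLeast0LessThan)
qed

text \<open>An equality is a pair of opposite inequalities, so later constructions only have to
  treat inequalities.\<close>

lemma convex_polyhedron_iff:
  "convex_polyhedron K e P \<longleftrightarrow>
    (\<exists>I. finite I \<and> (\<forall>(a, b)\<in>I. length a = e) \<and> P = {x \<in> points K e. \<forall>(a, b)\<in>I. lin a x \<le> b})"
  (is "_ \<longleftrightarrow> ?R")
proof
  assume "convex_polyhedron K e P"
  then obtain I E where IE: "finite I" "finite E" "\<forall>(a, b) \<in> I \<union> E. length a = e"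
    "P = {x \<in> points K e. (\<forall>(a, b) \<in> I. lin a x \<le> b) \<and> (\<forall>(a, b) \<in> E. lin a x = b)}"
    unfolding convex_polyhedron_def by blast
  define J where "J = I \<union> E \<union> (\<lambda>(a, b). (map uminus a, - b)) ` E"
  have len: "length a = e" if "(a, b) \<in> I \<union> E" for a b
    using IE(3) that by blast
  have "finite J" using IE(1,2) by (simp add: J_def)
  moreover have "\<forall>(a, b)\<in>J. length a = e"
    unfolding J_def by (auto intro: len)
  moreover have "P = {x \<in> points K e. \<forall>(a, b)\<in>J. lin a x \<le> b}"
  proof -
    have "(\<forall>(a, b)\<in>J. lin a x \<le> b) \<longleftrightarrow>
      (\<forall>(a, b)\<in>I. lin a x \<le> b) \<and> (\<forall>(a, b)\<in>E. lin a x = b)" for x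
    proof -
      have "(\<forall>(a, b)\<in>E. lin a x = b) \<longleftrightarrow>
        (\<forall>(a, b)\<in>E. lin a x \<le> b) \<and> (\<forall>(a, b)\<in>E. lin (map uminus a) x \<le> - b)"
        by (fastforce simp: lin_map_uminus intro: antisym)
      then show ?thesis unfolding J_def ball_Un by (simp add: case_prod_unfold)
    qed
    then show ?thesis unfolding IE(4) by simp
  qed
  ultimately show ?R by blast
next
  assume ?R
  then obtain I where "finite I" "\<forall>(a, b)\<in>I. length a = e"
    "P = {x \<in> points K e. \<forall>(a, b)\<in>I. lin a x \<le> b}" by blast
  then show "convex_polyhedron K e P"
    unfolding convex_polyhedron_def by (intro exI[of _ I] exI[of _ "{}"]) auto
qed

lemma convex_polyhedron_empty: "convex_polyhedron K e {}"
  unfolding convex_polyhedron_iff by (intro exI[of _ "{(replicate e 0, -1)}"]) auto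

section \<open>Coding the control state\<close>

text \<open>
  The paper's \<open>N\<close> is \<open>n + 2\<close> here: the ordinary control states are \<open>0, \<dots>, n\<close>, and \<open>n + 1\<close> is the bad
  one. The point \<open>x\<close> in control state \<open>q\<close> is coded at every scale \<open>t \<ge> \<parallel>x\<parallel>\<^sub>\<infinity>\<close>, with the vertex \<open>q\<close> of the
  standard simplex (the origin for \<open>q = 0\<close>) multiplied by \<open>1 + t\<close>.
\<close>

definition enc :: "nat \<Rightarrow> nat \<Rightarrow> rat \<Rightarrow> rat list \<Rightarrow> rat list" where
  "enc n q t x = x @ t # map (\<lambda>k. if Suc k = q then 1 + t else 0) [0..<n]"

definition bounded_by :: "rat list \<Rightarrow> rat \<Rightarrow> bool" where
  "bounded_by x t \<longleftrightarrow> (\<forall>i<length x. \<bar>x ! i\<bar> \<le> t)"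

lemma length_enc [simp]: "length (enc n q t x) = length x + Suc n"
  by (simp add: enc_def)

lemma take_enc [simp]: "m \<le> length x \<Longrightarrow> take m (enc n q t x) = take m x"
  by (simp add: enc_def)

lemma lin_enc_coordinates: "length a \<le> length x \<Longrightarrow> lin a (enc n q t x) = lin a x"
  by (auto simp: lin_def enc_def nth_append intro!: sum.cong)

text \<open>The simplex block has at most one nonzero entry, at index q - 1, and is zero for q = 0
  and for q > n.\<close>

lemma lin_enc:
  assumes "length a = length x"
  shows "lin (a @ \<alpha> # map \<beta> [0..<n]) (enc n q t x) =
    lin a x + \<alpha> * t + (if 1 \<le> q \<and> q \<le> n then \<beta> (q - 1) * (1 + t) else 0)"
proof -
  have "(\<Sum>k<n. \<beta> k * map (\<lambda>k. if Suc k = q then 1 + t else 0) [0..<n] ! k) =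
    (\<Sum>k<n. if k = q - 1 \<and> 1 \<le> q then \<beta> k * (1 + t) else 0)"
    by (intro sum.cong) auto
  also have "\<dots> = (if 1 \<le> q \<and> q \<le> n then \<beta> (q - 1) * (1 + t) else 0)"
    by (cases q) auto
  finally show ?thesis
    using assms by (simp add: enc_def lin_append lin_map)
qed

text \<open>The simplex entries are 0 or 1 + t, so no fractions arise and integer scales work over
  the integers.\<close>

lemma enc_in_points:
  assumes "K = \<int> \<or> K = UNIV"
  shows "enc n q t x \<in> points K (d + Suc n) \<longleftrightarrow> x \<in> points K d \<and> t \<in> K"
  using assms by (auto simp: points_def enc_def)

text \<open>The initial point of the simulation is thus the code of the original initial state at
  scale 0.\<close>

lemma replicate_zero_enc: "replicate (d + Suc n) 0 = enc n 0 0 (replicate d 0)"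
  by (simp add: enc_def replicate_add map_replicate_const replicate_append_same)

lemma bounded_by_zero: "bounded_by (replicate d 0) t \<longleftrightarrow> 0 \<le> t \<or> d = 0"
  by (auto simp: bounded_by_def)

text \<open>A coordinate must exist to force t >= 0; this separates ordinary codes from the scale -1
  of bad successors.\<close>

lemma bounded_by_nonneg: "bounded_by x t \<Longrightarrow> length x \<ge> 1 \<Longrightarrow> 0 \<le> t"
  unfolding bounded_by_def by (meson abs_ge_zero less_le_trans order_trans zero_less_one)

lemma eventually_bounded_by: "eventually (bounded_by x) at_top"
proof -
  have "\<forall>\<^sub>F t in at_top. \<forall>i\<in>{..<length x}. \<bar>x ! i\<bar> \<le> t"
    by (intro eventually_ball_finite ballI eventually_ge_at_top) simp
  then show ?thesis by (rule eventually_mono) (simp add: bounded_by_def)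
qed

text \<open>The scaled barycentric coordinate of the vertex \<open>q\<close> is \<open>vertex_form d n q \<cdot> z + [q = 0]\<close>.\<close>

definition vertex_form :: "nat \<Rightarrow> nat \<Rightarrow> nat \<Rightarrow> rat list" where
  "vertex_form d n q = replicate d 0 @ of_bool (q = 0) #
     map (\<lambda>k. if q = 0 then -1 else of_bool (Suc k = q)) [0..<n]"

lemma length_vertex_form [simp]: "length (vertex_form d n q) = d + Suc n"
  by (simp add: vertex_form_def)

text \<open>The scaled barycentric coordinates sum to 1 + t. At t = -1 all of them vanish, which
  admits the extra index n + 1.\<close>

lemma lin_vertex_form:
  assumes "length x = d" "p \<le> n" "q \<le> n \<or> t = -1"
  shows "lin (vertex_form d n p) (enc n q t x) + of_bool (p = 0) = (1 + t) * of_bool (p = q)"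
  using assms unfolding vertex_form_def by (auto simp: lin_enc)

section \<open>The simulating formula\<close>

text \<open>The syntax has no truth constants; 0 <= 0 serves as truth, and 0 <= -1 as falsity in
  \<open>disjs\<close>.\<close>

definition conjs :: "fm list \<Rightarrow> fm" where
  "conjs \<phi>s = foldr Conj \<phi>s (Lin Le [] [] 0)"

definition disjs :: "fm list \<Rightarrow> fm" where
  "disjs \<phi>s = foldr Disj \<phi>s (Lin Le [] [] (-1))"

lemma holds_conjs [simp]: "holds L (conjs \<phi>s) q x q' x' \<longleftrightarrow> (\<forall>\<phi>\<in>set \<phi>s. holds L \<phi> q x q' x')"
  by (induction \<phi>s) (auto simp: conjs_def)

lemma holds_disjs [simp]: "holds L (disjs \<phi>s) q x q' x' \<longleftrightarrow> (\<exists>\<phi>\<in>set \<phi>s. holds L \<phi> q x q' x')"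
  by (induction \<phi>s) (auto simp: disjs_def)

lemma wf_conjs [simp]: "wf_fm L M e (conjs \<phi>s) \<longleftrightarrow> (\<forall>\<phi>\<in>set \<phi>s. wf_fm L M e \<phi>)"
  by (induction \<phi>s) (auto simp: conjs_def)

lemma wf_disjs [simp]: "wf_fm L M e (disjs \<phi>s) \<longleftrightarrow> (\<forall>\<phi>\<in>set \<phi>s. wf_fm L M e \<phi>)"
  by (induction \<phi>s) (auto simp: disjs_def)

text \<open>The flag \<open>p\<close> selects the primed variables.\<close>

definition atom :: "bool \<Rightarrow> rel \<Rightarrow> rat list \<Rightarrow> rat \<Rightarrow> fm" where
  "atom p r a b = (if p then Lin r [] a b else Lin r a [] b)"

lemma holds_atom [simp]:
  "holds L (atom p r a b) q x q' x' \<longleftrightarrow> rel_holds r (lin a (if p then x' else x)) b"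
  by (simp add: atom_def)

lemma wf_atom [simp]: "wf_fm L M e (atom p r a b) \<longleftrightarrow> length a \<le> e"
  by (simp add: atom_def)

text \<open>The entries add up when i = j, so a single coordinate is obtained with b = 0.\<close>

definition two_coeffs :: "nat \<Rightarrow> nat \<Rightarrow> rat \<Rightarrow> nat \<Rightarrow> rat \<Rightarrow> rat list" where
  "two_coeffs m i a j b = map (\<lambda>k. (if k = i then a else 0) + (if k = j then b else 0)) [0..<m]"

lemma length_two_coeffs [simp]: "length (two_coeffs m i a j b) = m"
  by (simp add: two_coeffs_def)

lemma lin_two_coeffs [simp]:
  assumes "i < m" "j < m"
  shows "lin (two_coeffs m i a j b) x = a * x ! i + b * x ! j"
proof -
  have "lin (two_coeffs m i a j b) x =
    (\<Sum>k<m. (if k = i then a * x ! k else 0) + (if k = j then b * x ! k else 0))"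
    unfolding two_coeffs_def lin_map by (intro sum.cong) (auto simp: distrib_right)
  then show ?thesis using assms by (simp add: sum.distrib)
qed

definition bound_fm :: "nat \<Rightarrow> nat \<Rightarrow> bool \<Rightarrow> fm" where
  "bound_fm d n p = conjs (concat (map (\<lambda>i.
     [atom p Le (two_coeffs (d + Suc n) i 1 d (-1)) 0,
      atom p Le (two_coeffs (d + Suc n) i (-1) d (-1)) 0]) [0..<d]))"

definition vertex_fm :: "nat \<Rightarrow> nat \<Rightarrow> bool \<Rightarrow> nat \<Rightarrow> fm" where
  "vertex_fm d n p q = conjs (map (\<lambda>k.
     atom p Eq (two_coeffs (d + Suc n) (d + Suc k) 1 d (- of_bool (Suc k = q))) (of_bool (Suc k = q)))
     [0..<n])"

definition zero_fm :: "nat \<Rightarrow> nat \<Rightarrow> bool \<Rightarrow> fm" where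
  "zero_fm d n p = conjs (map (\<lambda>i. atom p Eq (two_coeffs (d + Suc n) i 1 i 0) 0) [0..<d])"

definition scale_fm :: "nat \<Rightarrow> nat \<Rightarrow> bool \<Rightarrow> rat \<Rightarrow> fm" where
  "scale_fm d n p t = atom p Eq (two_coeffs (d + Suc n) d 1 d 0) t"

definition code_fm :: "nat \<Rightarrow> nat \<Rightarrow> bool \<Rightarrow> fm" where
  "code_fm d n p = Conj (bound_fm d n p) (disjs (map (vertex_fm d n p) [0..<Suc n]))"

text \<open>The scaled barycentric coordinate of vertex \<open>q\<close> is required to be at least
  1; on codes with t >= 0 it is 0 or 1 + t. One atom suffices, so the translation acts letter by
  letter on Polish words.\<close>

definition state_fm :: "nat \<Rightarrow> nat \<Rightarrow> bool \<Rightarrow> nat \<Rightarrow> fm" where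
  "state_fm d n p q = atom p Le (map uminus (vertex_form d n q)) (of_bool (q = 0) - 1)"

lemma holds_bound_fm:
  "length z = d + Suc n \<Longrightarrow> z = (if p then x' else x) \<Longrightarrow>
    holds L (bound_fm d n p) q x q' x' \<longleftrightarrow> bounded_by (take d z) (z ! d)"
  by (fastforce simp: bound_fm_def bounded_by_def abs_le_iff minus_le_iff)

lemma holds_vertex_fm:
  assumes "length z = d + Suc n" "z = (if p then x' else x)"
  shows "holds L (vertex_fm d n p k) q x q' x' \<longleftrightarrow> z = enc n k (z ! d) (take d z)"
proof -
  have "holds L (vertex_fm d n p k) q x q' x' \<longleftrightarrow>
    (\<forall>j<n. z ! (d + Suc j) = (if Suc j = k then 1 + z ! d else 0))"
    unfolding vertex_fm_def using assms by (auto simp: algebra_simps)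
  also have "\<dots> \<longleftrightarrow> drop (Suc d) z = map (\<lambda>j. if Suc j = k then 1 + z ! d else 0) [0..<n]"
    using assms by (auto simp: list_eq_iff_nth_eq)
  also have "\<dots> \<longleftrightarrow> z = enc n k (z ! d) (take d z)"
  proof -
    have "z = take d z @ z ! d # drop (Suc d) z"
      using assms(1) by (intro id_take_nth_drop) simp
    then have "z = enc n k (z ! d) (take d z) \<longleftrightarrow> take d z @ z ! d # drop (Suc d) z = enc n k (z ! d) (take d z)"
      by (rule arg_cong)
    then show ?thesis by (simp add: enc_def)
  qed
  finally show ?thesis .
qed

lemma holds_code_fm:
  assumes "length z = d + Suc n" "z = (if p then x' else x)"
  shows "holds L (code_fm d n p) q x q' x' \<longleftrightarrow>
    (\<exists>k t y. k \<le> n \<and> length y = d \<and> bounded_by y t \<and> z = enc n k t y)"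
proof -
  have "holds L (code_fm d n p) q x q' x' \<longleftrightarrow>
    bounded_by (take d z) (z ! d) \<and> (\<exists>k\<le>n. z = enc n k (z ! d) (take d z))"
    unfolding code_fm_def using assms
    by (simp add: holds_bound_fm[OF assms] holds_vertex_fm[OF assms] less_Suc_eq_le Bex_def
        del: upt_Suc)
  also have "\<dots> \<longleftrightarrow> (\<exists>k t y. k \<le> n \<and> length y = d \<and> bounded_by y t \<and> z = enc n k t y)"
  proof
    assume "bounded_by (take d z) (z ! d) \<and> (\<exists>k\<le>n. z = enc n k (z ! d) (take d z))"
    moreover have "length (take d z) = d" using assms(1) by simp
    ultimately show "\<exists>k t y. k \<le> n \<and> length y = d \<and> bounded_by y t \<and> z = enc n k t y" by blast
  next
    assume "\<exists>k t y. k \<le> n \<and> length y = d \<and> bounded_by y t \<and> z = enc n k t y"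
    then show "bounded_by (take d z) (z ! d) \<and> (\<exists>k\<le>n. z = enc n k (z ! d) (take d z))"
      by (auto simp: enc_def nth_append)
  qed
  finally show ?thesis .
qed

lemma holds_zero_fm:
  assumes "length x' = d + Suc n"
  shows "holds L (zero_fm d n True) q x q' x' \<longleftrightarrow> take d x' = replicate d 0"
  using assms by (auto simp: zero_fm_def list_eq_iff_nth_eq)

lemma holds_scale_fm [simp]: "holds L (scale_fm d n True t) q x q' x' \<longleftrightarrow> x' ! d = t"
  by (simp add: scale_fm_def)

lemma holds_state_fm:
  assumes "k \<le> n" "length y = d" "j \<le> n \<and> 0 \<le> t \<or> t = -1"
    "(if p then x' else x) = enc n j t y"
  shows "holds L (state_fm d n p k) q x q' x' \<longleftrightarrow> k = j \<and> t \<noteq> -1"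
proof -
  have "lin (vertex_form d n k) (enc n j t y) + of_bool (k = 0) = (1 + t) * of_bool (k = j)"
    using assms by (intro lin_vertex_form) auto
  then show ?thesis
    using assms(3) by (auto simp: state_fm_def assms(4) lin_map_uminus of_bool_def split: if_splits)
qed

text \<open>Arithmetic atoms are kept because \<open>x\<close> fills the first \<open>d\<close>
  coordinates of its code. Sources are only codes of ordinary states, hence
  \<open>Cur (n + 1)\<close> becomes false.\<close>

fun translate :: "nat \<Rightarrow> nat \<Rightarrow> fm \<Rightarrow> fm" where
  "translate d n (Cur k) = (if k \<le> n then state_fm d n False k else Lin Le [] [] (-1))"
| "translate d n (Nxt k) = (if k \<le> n then state_fm d n True k else Nxt 1)"
| "translate d n (Neg \<phi>) = Neg (translate d n \<phi>)"
| "translate d n (Conj \<phi> \<psi>) = Conj (translate d n \<phi>) (translate d n \<psi>)"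
| "translate d n (Disj \<phi> \<psi>) = Disj (translate d n \<phi>) (translate d n \<psi>)"
| "translate d n \<phi> = \<phi>"

text \<open>
  The scale \<open>-1\<close> makes the vertex coordinates vanish, so that every successor that is to be bad can
  be represented without satisfying any of the formulas for \<open>q' = k\<close> with \<open>k \<le> n\<close>.
\<close>

definition frame_fm :: "nat \<Rightarrow> nat \<Rightarrow> fm" where
  "frame_fm d n = Conj (Cur 0) (Conj (code_fm d n False)
     (Disj (Conj (Nxt 0) (code_fm d n True))
           (Conj (Nxt 1) (Conj (scale_fm d n True (-1)) (vertex_fm d n True (Suc n))))))"

text \<open>
  A transition to the initial point, at an arbitrary scale, is always possible: every invariant
  contains that point anyhow.
\<close>

definition reset_fm :: "nat \<Rightarrow> nat \<Rightarrow> fm" where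
  "reset_fm d n = Conj (Nxt 0) (Conj (zero_fm d n True) (state_fm d n True 0))"

definition simulation :: "nat \<Rightarrow> nat \<Rightarrow> fm \<Rightarrow> fm" where
  "simulation d n \<phi> = Conj (frame_fm d n) (Disj (reset_fm d n) (translate d n \<phi>))"

lemma wf_simulation:
  assumes "wf_fm L (Suc (Suc n)) d \<phi>"
  shows "wf_fm L 2 (d + Suc n) (simulation d n \<phi>)"
proof -
  have state: "wf_fm L 2 (d + Suc n) (state_fm d n p k)" for p k
    by (simp add: state_fm_def)
  have "wf_fm L 2 (d + Suc n) (translate d n \<phi>)"
    using assms by (induction \<phi>) (auto simp: state simp del: add_Suc_right)
  then show ?thesis
    by (auto simp: simulation_def frame_fm_def reset_fm_def state code_fm_def bound_fm_def
        vertex_fm_def zero_fm_def scale_fm_def simp del: add_Suc_right)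
qed

text \<open>The scales \<open>t\<close> and \<open>t'\<close> do not influence the truth value, so
  one original transition yields transitions between codes at all admissible scales.\<close>

lemma holds_translate:
  assumes "wf_fm L (Suc (Suc n)) d \<phi>" "length x = d" "length x' = d" "q \<le> n" "0 \<le> t"
    and "c' = 0 \<and> q' \<le> n \<and> 0 \<le> t' \<or> c' = 1 \<and> q' = Suc n \<and> t' = -1"
  shows "holds L (translate d n \<phi>) c (enc n q t x) c' (enc n q' t' x') \<longleftrightarrow> holds L \<phi> q x q' x'"
  using assms(1)
proof (induction \<phi>)
  case (Lin r a a' b)
  then show ?case using assms(2,3) by (simp add: lin_enc_coordinates)
next
  case (Cur k)
  have "holds L (state_fm d n False k) c (enc n q t x) c' (enc n q' t' x') \<longleftrightarrow> k = q" if "k \<le> n"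
    using holds_state_fm[OF that assms(2), of q t False "enc n q' t' x'" "enc n q t x" L c c'] assms(4,5)
    by simp
  then show ?case using Cur assms(4) by auto
next
  case (Nxt k)
  have "holds L (state_fm d n True k) c (enc n q t x) c' (enc n q' t' x') \<longleftrightarrow> k = q'" if "k \<le> n"
    using holds_state_fm[OF that assms(3), of q' t' True "enc n q' t' x'" "enc n q t x" L c c'] assms(6) that
    by auto
  then show ?case using Nxt assms(6) by auto
qed (use assms(2,3) in auto)

lemma holds_frame_fm:
  assumes "length z = d + Suc n" "length z' = d + Suc n"
  shows "holds L (frame_fm d n) c z c' z' \<longleftrightarrow> c = 0 \<and>
    (\<exists>q t x q' t' x'. q \<le> n \<and> length x = d \<and> bounded_by x t \<and> z = enc n q t x \<and>
      length x' = d \<and> z' = enc n q' t' x' \<and>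
      (c' = 0 \<and> q' \<le> n \<and> bounded_by x' t' \<or> c' = 1 \<and> q' = Suc n \<and> t' = -1))"
proof -
  \<comment> \<open>Index n + 1 matches no simplex coordinate, so this \<open>vertex_fm\<close>
    makes all of them zero.\<close>
  have "(z' ! d = -1 \<and> z' = enc n (Suc n) (z' ! d) (take d z')) \<longleftrightarrow>
    (\<exists>x'. length x' = d \<and> z' = enc n (Suc n) (-1) x')"
  proof
    assume "z' ! d = -1 \<and> z' = enc n (Suc n) (z' ! d) (take d z')"
    moreover have "length (take d z') = d" using assms(2) by simp
    ultimately show "\<exists>x'. length x' = d \<and> z' = enc n (Suc n) (-1) x'" by metis
  qed (auto simp: enc_def nth_append)
  then show ?thesis
    using holds_code_fm[OF assms(1), of False z' z L c c'] holds_code_fm[OF assms(2), of True z' z L c c']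
      holds_vertex_fm[OF assms(2), of True z' z L "Suc n" c c']
    by (simp add: frame_fm_def) blast
qed

lemma holds_simulation:
  assumes "wf_fm L (Suc (Suc n)) d \<phi>" "1 \<le> d" "length z = d + Suc n" "length z' = d + Suc n"
  shows "holds L (simulation d n \<phi>) c z c' z' \<longleftrightarrow> c = 0 \<and>
    (\<exists>q t x q' t' x'. q \<le> n \<and> length x = d \<and> bounded_by x t \<and> z = enc n q t x \<and>
      length x' = d \<and> z' = enc n q' t' x' \<and>
      (c' = 0 \<and> q' \<le> n \<and> bounded_by x' t' \<and> (q' = 0 \<and> x' = replicate d 0 \<or> holds L \<phi> q x q' x') \<or>
       c' = 1 \<and> q' = Suc n \<and> t' = -1 \<and> holds L \<phi> q x q' x'))"
proof -
  have disj: "holds L (Disj (reset_fm d n) (translate d n \<phi>)) c (enc n q t x) c' (enc n q' t' x') \<longleftrightarrow>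
    c' = 0 \<and> q' = 0 \<and> x' = replicate d 0 \<or> holds L \<phi> q x q' x'"
    if "q \<le> n" "length x = d" "bounded_by x t" "length x' = d"
      and step: "c' = 0 \<and> q' \<le> n \<and> bounded_by x' t' \<or> c' = 1 \<and> q' = Suc n \<and> t' = -1"
    for q t x q' t' x'
  proof -
    have t: "0 \<le> t" using that assms(2) by (intro bounded_by_nonneg[of x]) auto
    have t': "c' = 0 \<and> q' \<le> n \<and> 0 \<le> t' \<or> c' = 1 \<and> q' = Suc n \<and> t' = -1"
      using step that(4) assms(2) bounded_by_nonneg[of x' t'] by auto
    have "holds L (state_fm d n True 0) c (enc n q t x) c' (enc n q' t' x') \<longleftrightarrow> 0 = q' \<and> t' \<noteq> -1"
      using t' that(4) by (intro holds_state_fm) auto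
    then show ?thesis
      using holds_translate[OF assms(1) that(2,4,1) t t', of c] t' that(4)
      by (auto simp: reset_fm_def holds_zero_fm)
  qed
  show ?thesis
    (is "_ \<longleftrightarrow> c = 0 \<and> (\<exists>q t x q' t' x'. ?codes q t x q' t' x')")
  proof
    assume "holds L (simulation d n \<phi>) c z c' z'"
    then have frame: "holds L (frame_fm d n) c z c' z'"
      and step: "holds L (Disj (reset_fm d n) (translate d n \<phi>)) c z c' z'"
      by (simp_all add: simulation_def)
    from frame obtain q t x q' t' x' where c: "c = 0"
      and x: "q \<le> n" "length x = d" "bounded_by x t" "z = enc n q t x"
      and x': "length x' = d" "z' = enc n q' t' x'"
        "c' = 0 \<and> q' \<le> n \<and> bounded_by x' t' \<or> c' = 1 \<and> q' = Suc n \<and> t' = -1"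
      unfolding holds_frame_fm[OF assms(3,4)] by blast
    have "?codes q t x q' t' x'"
      using step disj[OF x(1-3) x'(1,3)] x x' by auto
    with c show "c = 0 \<and> (\<exists>q t x q' t' x'. ?codes q t x q' t' x')" by blast
  next
    assume "c = 0 \<and> (\<exists>q t x q' t' x'. ?codes q t x q' t' x')"
    then obtain q t x q' t' x' where c: "c = 0" and codes: "?codes q t x q' t' x'" by blast
    then have "holds L (frame_fm d n) c z c' z'"
      unfolding holds_frame_fm[OF assms(3,4)] by blast
    moreover have "holds L (Disj (reset_fm d n) (translate d n \<phi>)) c z c' z'"
      using codes disj[of q x t x' q' t'] by auto
    ultimately show "holds L (simulation d n \<phi>) c z c' z'"
      by (simp add: simulation_def)
  qed
qed

section \<open>Correctness\<close>

lemma transitions_iff: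
  "((q, x), (q', x')) \<in> transitions K L M e \<phi> \<longleftrightarrow>
    q < M \<and> q' < M \<and> x \<in> points K e \<and> x' \<in> points K e \<and> holds L \<phi> q x q' x'"
  by (auto simp: transitions_def states_def)

lemma length_points: "x \<in> points K e \<Longrightarrow> length x = e"
  by (simp add: points_def)

text \<open>
  The function \<open>1 + t - vertex_form d n q \<cdot> z - [q = 0]\<close> vanishes on the codes of control state \<open>q\<close> and
  equals \<open>1 + t\<close> on those of the other states; \<open>relax n c q a\<close> subtracts \<open>c\<close> times its linear part.
\<close>

definition relax :: "nat \<Rightarrow> rat \<Rightarrow> nat \<Rightarrow> rat list \<Rightarrow> rat list" where
  "relax n c q a = a @ c * (of_bool (q = 0) - 1) #
     map (\<lambda>k. c * (if q = 0 then -1 else of_bool (Suc k = q))) [0..<n]"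

lemma lin_relax:
  assumes "length a = length x" "p \<le> n" "q \<le> n"
  shows "lin (relax n c q a) (enc n p t x) =
    lin a x - c * (1 + t) * of_bool (p \<noteq> q) + c * (1 - of_bool (q = 0))"
  using assms unfolding relax_def by (auto simp: lin_enc algebra_simps)

section \<open>From an invariant of the system to one of its simulation\<close>

lemma simulation_has_invariant:
  assumes K: "K = \<int> \<or> K = UNIV" and d: "1 \<le> d" and wf: "wf_fm L (Suc (Suc n)) d \<phi>"
    and P: "separating_invariant K L (Suc (Suc n)) d \<phi> P"
  shows "has_separating_invariant K L 2 (d + Suc n) (simulation d n \<phi>)"
proof -
  from P have poly: "\<forall>q<Suc (Suc n). convex_polyhedron K d (P q)"
    and init: "replicate d 0 \<in> P 0" and bad: "P (Suc n) = {}"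
    and step: "\<And>q x q' x'. x \<in> P q \<Longrightarrow> ((q, x), (q', x')) \<in> transitions K L (Suc (Suc n)) d \<phi> \<Longrightarrow> x' \<in> P q'"
    unfolding separating_invariant_def by auto
  have "\<exists>I. q \<le> n \<longrightarrow> finite I \<and> (\<forall>(a, b)\<in>I. length a = d) \<and>
    P q = {x \<in> points K d. \<forall>(a, b)\<in>I. lin a x \<le> b}" for q
  proof (cases "q \<le> n")
    case True
    with poly have "convex_polyhedron K d (P q)" by simp
    with True show ?thesis unfolding convex_polyhedron_iff by simp
  qed simp
  then have "\<exists>I. \<forall>q. q \<le> n \<longrightarrow> finite (I q) \<and> (\<forall>(a, b)\<in>I q. length a = d) \<and>
    P q = {x \<in> points K d. \<forall>(a, b)\<in>I q. lin a x \<le> b}"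
    by (intro choice allI)
  then obtain I where I: "\<forall>q. q \<le> n \<longrightarrow> finite (I q) \<and> (\<forall>(a, b)\<in>I q. length a = d) \<and>
    P q = {x \<in> points K d. \<forall>(a, b)\<in>I q. lin a x \<le> b}" ..
  then have fin: "finite (I q)" and len: "(a, b) \<in> I q \<Longrightarrow> length a = d"
    and Pq: "P q = {x \<in> points K d. \<forall>(a, b)\<in>I q. lin a x \<le> b}" if "q \<le> n" for q a b
    using I[rule_format, OF that(1)] by auto
  have "finite (\<Union>q\<le>n. I q)" using fin by blast
  \<comment> \<open>One constant \<open>c\<close> serves all inequalities: it gives a x <= c t and
    -b <= c, hence a x <= b + c (1 + t), so an inequality of another state is satisfied
    automatically.\<close>
  then have "bdd_above ((\<lambda>(a, b). (\<Sum>c\<leftarrow>a. \<bar>c\<bar>) + \<bar>b\<bar>) ` (\<Union>q\<le>n. I q))"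
    by (intro bdd_above_finite finite_imageI)
  then obtain c where "\<forall>y\<in>(\<lambda>(a, b). (\<Sum>c\<leftarrow>a. \<bar>c\<bar>) + \<bar>b\<bar>) ` (\<Union>q\<le>n. I q). y \<le> c"
    unfolding bdd_above_def by blast
  then have c: "(\<Sum>c\<leftarrow>a. \<bar>c\<bar>) + \<bar>b\<bar> \<le> c" if "q \<le> n" "(a, b) \<in> I q" for q a b
    using that by fastforce
  \<comment> \<open>The constant part of c times the vanishing function of state \<open>q\<close>
    moves to the right-hand side.\<close>
  define J where "J = (\<Union>q\<le>n. (\<lambda>(a, b). (relax n c q a, b + c * (1 - of_bool (q = 0)))) ` I q)"
  define R where "R = {z \<in> points K (d + Suc n). \<forall>(a, b)\<in>J. lin a z \<le> b}"
  have "finite J" unfolding J_def using fin by blast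
  moreover have "\<forall>(a, b)\<in>J. length a = d + Suc n"
    unfolding J_def by (auto simp: relax_def intro: len)
  ultimately have R_poly: "convex_polyhedron K (d + Suc n) R"
    unfolding convex_polyhedron_iff R_def by blast
  have R_iff: "enc n p t x \<in> R \<longleftrightarrow> x \<in> P p"
    if p: "p \<le> n" and x: "x \<in> points K d" and t: "t \<in> K" "bounded_by x t" for p t x
  proof -
    have t0: "0 \<le> t" using t(2) length_points[OF x] d by (intro bounded_by_nonneg) auto
    have relaxed: "lin (relax n c q a) (enc n p t x) \<le> b + c * (1 - of_bool (q = 0)) \<longleftrightarrow>
      q = p \<longrightarrow> lin a x \<le> b" if q: "q \<le> n" and ab: "(a, b) \<in> I q" for q a b
    proof -
      have la: "length a = length x" using len[OF q ab] length_points[OF x] by simp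
      have nonneg: "0 \<le> (\<Sum>c\<leftarrow>a. \<bar>c\<bar>)" by (intro sum_list_nonneg) auto
      have "lin a x \<le> (\<Sum>c\<leftarrow>a. \<bar>c\<bar>) * t"
        using abs_lin_le[OF la, of t] t(2) by (auto simp: bounded_by_def)
      also have "\<dots> \<le> c * t"
        using c[OF q ab] t0 by (intro mult_right_mono) auto
      finally have "lin a x \<le> b + c * (1 + t)"
        using c[OF q ab] nonneg by (simp add: distrib_left)
      then show ?thesis
        unfolding lin_relax[OF la p q] by (cases "q = p") (auto simp: algebra_simps)
    qed
    have "enc n p t x \<in> R \<longleftrightarrow> (\<forall>q\<le>n. \<forall>(a, b)\<in>I q. q = p \<longrightarrow> lin a x \<le> b)"
      unfolding R_def J_def using enc_in_points[OF K] x t(1) relaxed by fastforce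
    then show ?thesis using p x Pq[OF p] by auto
  qed
  have zero: "replicate d 0 \<in> points K d" "0 \<in> K"
    using K by (auto simp: points_def)
  have R_step: "z' \<in> (if c' = 0 then R else {})"
    if z: "z \<in> R" and tr: "((0, z), (c', z')) \<in> transitions K L 2 (d + Suc n) (simulation d n \<phi>)" for z c' z'
  proof -
    from tr have pts: "z \<in> points K (d + Suc n)" "z' \<in> points K (d + Suc n)"
      and holds: "holds L (simulation d n \<phi>) 0 z c' z'" by (auto simp: transitions_iff)
    from holds obtain q t x q' t' x' where q: "q \<le> n" and x: "bounded_by x t" "z = enc n q t x"
      and z': "z' = enc n q' t' x'" and alt:
      "c' = 0 \<and> q' \<le> n \<and> bounded_by x' t' \<and> (q' = 0 \<and> x' = replicate d 0 \<or> holds L \<phi> q x q' x') \<or>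
       c' = 1 \<and> q' = Suc n \<and> t' = -1 \<and> holds L \<phi> q x q' x'"
      unfolding holds_simulation[OF wf d length_points[OF pts(1)] length_points[OF pts(2)]] by blast
    have in_K: "x \<in> points K d" "t \<in> K" "x' \<in> points K d" "t' \<in> K"
      using pts enc_in_points[OF K] unfolding x z' by auto
    have xP: "x \<in> P q" using z R_iff[OF q in_K(1,2) x(1)] unfolding x by simp
    have P_step: "x' \<in> P q'" if "holds L \<phi> q x q' x'" "q' \<le> Suc n"
      using step[OF xP] that q in_K by (simp add: transitions_iff)
    show ?thesis
    proof (cases "c' = 0")
      case True
      then have "q' \<le> n" "bounded_by x' t'" "x' \<in> P q'" using alt init P_step by auto
      then show ?thesis using True R_iff in_K z' by simp
    next
      case False
      \<comment> \<open>A step to the bad state would put \<open>x'\<close> into the empty set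
        \<open>P (Suc n)\<close>.\<close>
      then show ?thesis using alt P_step bad by auto
    qed
  qed
  have "separating_invariant K L 2 (d + Suc n) (simulation d n \<phi>) (\<lambda>c. if c = 0 then R else {})"
    unfolding separating_invariant_def
  proof (intro conjI allI impI)
    show "replicate (d + Suc n) 0 \<in> (if (0::nat) = 0 then R else {})"
      unfolding replicate_zero_enc using R_iff[of 0 "replicate d 0" 0] zero init by (simp add: bounded_by_zero)
  next
    fix c c' :: nat and z z' :: "rat list"
    assume "z \<in> (if c = 0 then R else {})"
    then have "c = 0" "z \<in> R" by (auto split: if_splits)
    moreover assume "((c, z), (c', z')) \<in> transitions K L 2 (d + Suc n) (simulation d n \<phi>)"
    ultimately show "z' \<in> (if c' = 0 then R else {})" using R_step by blast
  qed (use R_poly in \<open>simp_all add: convex_polyhedron_empty\<close>)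
  then show ?thesis unfolding has_separating_invariant_def by blast
qed

section \<open>From an invariant of the simulation to one of the system\<close>

lemma eventually_affine_le:
  fixes K :: "rat set"
  assumes "K = \<int> \<or> K = UNIV"
  shows "(\<forall>\<^sub>F t in at_top. t \<in> K \<longrightarrow> u + s * t \<le> v) \<longleftrightarrow> s < 0 \<or> s = 0 \<and> u \<le> v"
proof
  assume "\<forall>\<^sub>F t in at_top. t \<in> K \<longrightarrow> u + s * t \<le> v"
  then obtain t0 where t0: "\<And>t. t0 \<le> t \<Longrightarrow> t \<in> K \<Longrightarrow> u + s * t \<le> v"
    unfolding eventually_at_top_linorder by blast
  \<comment> \<open>This scale lies in the range of the assumed bound; for s > 0 it would give u + s
    m >= v + 1.\<close>
  obtain m where m: "max t0 ((v - u + 1) / s) \<le> of_nat m"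
    using real_arch_simple by blast
  moreover have "of_nat m \<in> K" using assms by auto
  ultimately have "u + s * of_nat m \<le> v" using t0 by simp
  moreover have "v - u + 1 \<le> s * of_nat m" if "s > 0"
    using m that by (simp add: field_simps)
  ultimately show "s < 0 \<or> s = 0 \<and> u \<le> v"
    by (cases s "0 :: rat" rule: linorder_cases) auto
next
  assume "s < 0 \<or> s = 0 \<and> u \<le> v"
  then show "\<forall>\<^sub>F t in at_top. t \<in> K \<longrightarrow> u + s * t \<le> v"
  proof
    assume "s < 0"
    then have "u + s * t \<le> v" if "t \<ge> (v - u) / s" for t
      using that by (simp add: field_simps)
    then show ?thesis unfolding eventually_at_top_linorder by blast
  qed simp
qed

text \<open>Along the codes of a fixed \<open>x\<close> each inequality is affine in
  \<open>t\<close>, with a slope independent of \<open>x\<close>. Finiteness lets "eventually" pass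
  through the conjunction.\<close>

lemma convex_polyhedron_asymptotic_slice:
  assumes K: "K = \<int> \<or> K = UNIV" and R: "convex_polyhedron K (d + Suc n) R"
  shows "convex_polyhedron K d {x \<in> points K d. \<forall>\<^sub>F t in at_top. t \<in> K \<longrightarrow> enc n q t x \<in> R}"
proof -
  obtain I where I: "finite I" "\<forall>(a, b)\<in>I. length a = d + Suc n"
    and R: "R = {z \<in> points K (d + Suc n). \<forall>(a, b)\<in>I. lin a z \<le> b}"
    using R unfolding convex_polyhedron_iff by blast
  \<comment> \<open>This is the coefficient of the coordinate with value 1 + t; it enters both the
    constant term and the slope.\<close>
  define \<delta> :: "rat list \<Rightarrow> rat" where "\<delta> a = (if 1 \<le> q \<and> q \<le> n then a ! (d + q) else 0)" for a
  define s where "s a = a ! d + \<delta> a" for a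
  have lin_s: "lin a (enc n q t x) = lin (take d a) x + \<delta> a + s a * t"
    if "length a = d + Suc n" "length x = d" for a t x
  proof -
    have "a = take d a @ a ! d # map (\<lambda>k. a ! (d + Suc k)) [0..<n]"
      using that(1) by (intro nth_equalityI) (auto simp: nth_append nth_Cons' intro!: arg_cong[of _ _ "nth a"])
    then have "lin a (enc n q t x) =
      lin (take d a @ a ! d # map (\<lambda>k. a ! (d + Suc k)) [0..<n]) (enc n q t x)" by simp
    also have "\<dots> = lin (take d a) x + \<delta> a + s a * t"
      using that by (subst lin_enc) (auto simp: \<delta>_def s_def algebra_simps)
    finally show ?thesis .
  qed
  \<comment> \<open>The pairs with zero coefficients stand for truth (right-hand side 0) and falsity
    (right-hand side -1).\<close>
  define h where "h = (\<lambda>(a, b). if s a < 0 then (replicate d 0, 0) else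
    if s a = 0 then (take d a, b - \<delta> a) else (replicate d 0, -1))"
  have "(\<forall>\<^sub>F t in at_top. t \<in> K \<longrightarrow> enc n q t x \<in> R) \<longleftrightarrow> (\<forall>(a, b)\<in>h ` I. lin a x \<le> b)"
    if x: "x \<in> points K d" for x
  proof -
    have "(\<forall>\<^sub>F t in at_top. t \<in> K \<longrightarrow> enc n q t x \<in> R) \<longleftrightarrow>
      (\<forall>\<^sub>F t in at_top. \<forall>ab\<in>I. t \<in> K \<longrightarrow> lin (fst ab) (enc n q t x) \<le> snd ab)"
      unfolding R using enc_in_points[OF K] x
      by (intro arg_cong[of _ _ "\<lambda>f. eventually f at_top"]) (auto simp: case_prod_unfold)
    also have "\<dots> \<longleftrightarrow> (\<forall>ab\<in>I. \<forall>\<^sub>F t in at_top. t \<in> K \<longrightarrow> lin (fst ab) (enc n q t x) \<le> snd ab)"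
      by (rule eventually_ball_finite_distrib[OF I(1)])
    also have "\<dots> \<longleftrightarrow> (\<forall>ab\<in>I. lin (fst (h ab)) x \<le> snd (h ab))"
    proof (rule ball_cong[OF refl])
      fix ab assume "ab \<in> I"
      then have "length (fst ab) = d + Suc n" using I(2) by auto
      then show "(\<forall>\<^sub>F t in at_top. t \<in> K \<longrightarrow> lin (fst ab) (enc n q t x) \<le> snd ab) \<longleftrightarrow>
        lin (fst (h ab)) x \<le> snd (h ab)"
        using lin_s length_points[OF x]
        by (simp add: eventually_affine_le[OF K] h_def case_prod_unfold) (auto simp: algebra_simps)
    qed
    finally show ?thesis by (simp add: case_prod_unfold)
  qed
  then have "{x \<in> points K d. \<forall>\<^sub>F t in at_top. t \<in> K \<longrightarrow> enc n q t x \<in> R} =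
    {x \<in> points K d. \<forall>(a, b)\<in>h ` I. lin a x \<le> b}" by blast
  moreover have "length (fst (h ab)) = d" if "ab \<in> I" for ab
    using I(2) that by (auto simp: h_def case_prod_unfold)
  then have "\<forall>(a, b)\<in>h ` I. length a = d"
    by (simp add: case_prod_unfold)
  ultimately show ?thesis
    unfolding convex_polyhedron_iff using I(1) by blast
qed

lemma invariant_of_simulation:
  assumes K: "K = \<int> \<or> K = UNIV" and d: "1 \<le> d" and wf: "wf_fm L (Suc (Suc n)) d \<phi>"
    and Q: "separating_invariant K L 2 (d + Suc n) (simulation d n \<phi>) Q"
  shows "has_separating_invariant K L (Suc (Suc n)) d \<phi>"
proof -
  from Q have poly: "convex_polyhedron K (d + Suc n) (Q 0)"
    and init: "replicate (d + Suc n) 0 \<in> Q 0" and bad: "Q 1 = {}"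
    and step: "\<And>c z c' z'. z \<in> Q c \<Longrightarrow>
      ((c, z), (c', z')) \<in> transitions K L 2 (d + Suc n) (simulation d n \<phi>) \<Longrightarrow> z' \<in> Q c'"
    unfolding separating_invariant_def by auto
  define P where "P q = (if q \<le> n
    then {x \<in> points K d. \<forall>\<^sub>F t in at_top. t \<in> K \<longrightarrow> enc n q t x \<in> Q 0} else {})" for q
  have sim: "enc n q' t' x' \<in> Q c'"
    if "enc n q t x \<in> Q 0" "q \<le> n" "x \<in> points K d" "x' \<in> points K d" "t \<in> K" "t' \<in> K" "bounded_by x t"
      "c' = 0 \<and> q' \<le> n \<and> bounded_by x' t' \<and> (q' = 0 \<and> x' = replicate d 0 \<or> holds L \<phi> q x q' x') \<or>
       c' = 1 \<and> q' = Suc n \<and> t' = -1 \<and> holds L \<phi> q x q' x'" for q t x c' q' t' x'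
  proof (rule step[OF that(1)])
    have len: "length x = d" "length x' = d"
      using that(3,4) by (auto simp: length_points)
    then have enc_len: "length (enc n q t x) = d + Suc n" "length (enc n q' t' x') = d + Suc n"
      by simp_all
    have "holds L (simulation d n \<phi>) 0 (enc n q t x) c' (enc n q' t' x')"
      unfolding holds_simulation[OF wf d enc_len] using that(2,7,8) len by blast
    then show "((0, enc n q t x), (c', enc n q' t' x')) \<in> transitions K L 2 (d + Suc n) (simulation d n \<phi>)"
      using that enc_in_points[OF K] by (auto simp: transitions_iff)
  qed
  have K_mem: "0 \<in> K" "-1 \<in> K" and zero: "replicate d 0 \<in> points K d"
    using K by (auto simp: points_def)
  \<comment> \<open>\<open>K\<close> is unbounded, so the condition on large scales in
    \<open>K\<close> is not vacuous and provides an actual source code.\<close>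
  have K_ex: "\<exists>t\<ge>t0. t \<in> K" for t0
    using real_arch_simple[of t0] K by auto
  have "\<forall>q<Suc (Suc n). convex_polyhedron K d (P q)"
    unfolding P_def using convex_polyhedron_asymptotic_slice[OF K poly]
    by (simp add: convex_polyhedron_empty)
  moreover have "replicate d 0 \<in> P 0"
  proof -
    \<comment> \<open>Initially only scale 0 is known to be in \<open>Q 0\<close>; the reset
      transition spreads membership to every nonnegative scale in \<open>K\<close>.\<close>
    have "enc n 0 t (replicate d 0) \<in> Q 0" if "0 \<le> t" "t \<in> K" for t
      using init unfolding replicate_zero_enc
      by (rule sim) (use that K_mem zero in \<open>auto simp: bounded_by_zero\<close>)
    then show ?thesis
      unfolding P_def eventually_at_top_linorder using zero by auto
  qed
  moreover have "P (Suc (Suc n) - 1) = {}" by (simp add: P_def)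
  moreover have "x' \<in> P q'"
    if x: "x \<in> P q" and tr: "((q, x), (q', x')) \<in> transitions K L (Suc (Suc n)) d \<phi>" for q x q' x'
  proof -
    from x have q: "q \<le> n" "x \<in> points K d" and ev: "\<forall>\<^sub>F t in at_top. t \<in> K \<longrightarrow> enc n q t x \<in> Q 0"
      by (auto simp: P_def split: if_splits)
    from eventually_conj[OF eventually_bounded_by[of x] ev] obtain t0 where "\<forall>t\<ge>t0. bounded_by x t \<and> (t \<in> K \<longrightarrow> enc n q t x \<in> Q 0)"
      unfolding eventually_at_top_linorder by blast
    with K_ex[of t0] obtain t where t: "t \<in> K" "bounded_by x t" "enc n q t x \<in> Q 0" by blast
    from tr have tr: "q' \<le> Suc n" "x' \<in> points K d" "holds L \<phi> q x q' x'"
      by (auto simp: transitions_iff)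
    show ?thesis
    proof (cases "q' \<le> n")
      case True
      \<comment> \<open>The target scale is free: from one source code a single step reaches all
        codes of the successor.\<close>
      have "bounded_by x' t' \<Longrightarrow> t' \<in> K \<Longrightarrow> enc n q' t' x' \<in> Q 0" for t'
        using sim[OF t(3) q tr(2) t(1) _ t(2)] True tr(3) by blast
      then show ?thesis
        unfolding P_def using True tr(2) eventually_mono[OF eventually_bounded_by[of x']] by simp
    next
      case False
      then have "enc n q' (-1) x' \<in> Q 1"
        using sim[OF t(3) q tr(2) t(1) K_mem(2) t(2)] tr by auto
      then show ?thesis using bad by simp
    qed
  qed
  ultimately have "separating_invariant K L (Suc (Suc n)) d \<phi> P"
    unfolding separating_invariant_def by blast
  then show ?thesis unfolding has_separating_invariant_def by blast
qed

section \<open>Computability\<close>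

text \<open>Translated control atoms are one-letter words, hence \<open>hd\<close>. The bounds on
  \<open>k\<close> leave only finitely many letters to change.\<close>

definition symbol_map :: "nat \<Rightarrow> nat \<Rightarrow> nat \<Rightarrow> nat" where
  "symbol_map d n z = (case prod_decode z of (i, k) \<Rightarrow>
     if i = 2 \<and> k \<le> Suc n then hd (polish (translate d n (Cur k)))
     else if i = 3 \<and> k \<le> Suc n then hd (polish (translate d n (Nxt k)))
     else z)"

lemma polish_translate:
  "wf_fm L (Suc (Suc n)) e \<phi> \<Longrightarrow> polish (translate d n \<phi>) = map (symbol_map d n) (polish \<phi>)"
  by (induction \<phi>) (simp_all add: symbol_map_def state_fm_def atom_def)

lemma computable_simulation: "computable_on (instances L (Suc (Suc n)) d) (simulation d n)"
proof (rule computable_onI)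
  let ?u = "polish (frame_fm d n)" and ?v = "polish (reset_fm d n)"
  \<comment> \<open>In prefix notation the added connectives and formulas form a fixed prefix, with
    nothing after the translated word.\<close>
  let ?h = "\<lambda>w. (prod_encode (5, 0) # ?u @ prod_encode (6, 0) # ?v) @ map (symbol_map d n) w"
  have "{z. symbol_map d n z \<noteq> z} \<subseteq> prod_encode ` ({2, 3} \<times> {..Suc n})"
  proof
    fix z assume "z \<in> {z. symbol_map d n z \<noteq> z}"
    then have "prod_decode z \<in> {2, 3} \<times> {..Suc n}"
      by (auto simp: symbol_map_def split: prod.splits if_splits)
    then show "z \<in> prod_encode ` ({2, 3} \<times> {..Suc n})"
      by (metis image_eqI prod_decode_inverse)
  qed
  then have "finite {z. symbol_map d n z \<noteq> z}"
    by (rule finite_subset) simp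
  then show "total_rec 1 (\<lambda>xs. list_encode (?h (list_decode (xs ! 0))))"
    by (intro total_rec_append total_rec_map total_rec_finite_change)
  show "polish (simulation d n \<phi>) = ?h (polish \<phi>)" if "\<phi> \<in> instances L (Suc (Suc n)) d" for \<phi>
    using that by (simp add: instances_def simulation_def polish_translate)
qed

section \<open>The case of a single control state, and the reduction\<close>

lemma computable_const: "computable_on S (\<lambda>_. \<psi>)"
  by (rule computable_onI[where h = "\<lambda>_. polish \<psi>"]) (simp_all add: total_rec_const)

text \<open>State 0 is then itself bad, and \<open>P 0\<close> would be empty yet contain the
  origin.\<close>

lemma no_invariant_single_state: "\<not> has_separating_invariant K L 1 d \<phi>"
  by (auto simp: has_separating_invariant_def separating_invariant_def)

text \<open>This supplies a fixed negative instance as the image of all instances with one control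
  state.\<close>

lemma no_invariant_initial_to_bad:
  assumes "K = \<int> \<or> K = UNIV"
  shows "\<not> has_separating_invariant K L 2 d (Conj (Cur 0) (Nxt 1))"
proof
  assume "has_separating_invariant K L 2 d (Conj (Cur 0) (Nxt 1))"
  then obtain P where "replicate d 0 \<in> P 0" "P 1 = {}" and
    step: "\<And>q x q' x'. x \<in> P q \<Longrightarrow> ((q, x), (q', x')) \<in> transitions K L 2 d (Conj (Cur 0) (Nxt 1)) \<Longrightarrow> x' \<in> P q'"
    unfolding has_separating_invariant_def separating_invariant_def by auto
  moreover have "((0, replicate d 0), (1, replicate d 0)) \<in> transitions K L 2 d (Conj (Cur 0) (Nxt 1))"
    using assms by (auto simp: transitions_iff points_def)
  ultimately show False by blast
qed

theorem theorem2:
  fixes K :: "rat set" and L :: arith_lang and d N :: nat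
  assumes "K = \<int> \<or> K = UNIV"
    and "d \<ge> 1" and "N \<ge> 1"
  shows "\<exists>F :: fm \<Rightarrow> fm.
    computable_on (instances L N d) F \<and>
    (\<forall>\<phi> \<in> instances L N d.
       F \<phi> \<in> instances L 2 (d + (N - 1)) \<and>
       (has_separating_invariant K L N d \<phi> \<longleftrightarrow>
        has_separating_invariant K L 2 (d + (N - 1)) (F \<phi>)))"
proof (cases "N = 1")
  case True
  then show ?thesis
    using no_invariant_single_state no_invariant_initial_to_bad[OF assms(1)]
    by (intro exI[of _ "\<lambda>_. Conj (Cur 0) (Nxt 1)"]) (simp add: computable_const instances_def)
next
  case False
  with assms(3) have "N = Suc (Suc (N - 2))" by simp
  then obtain n where N: "N = Suc (Suc n)" ..
  have "has_separating_invariant K L N d \<phi> \<longleftrightarrow>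
      has_separating_invariant K L 2 (d + Suc n) (simulation d n \<phi>)"
    if "\<phi> \<in> instances L N d" for \<phi>
    using that simulation_has_invariant[OF assms(1,2)] invariant_of_simulation[OF assms(1,2)]
    unfolding N instances_def has_separating_invariant_def by blast
  then show ?thesis
    using computable_simulation wf_simulation
    by (intro exI[of _ "simulation d n"]) (auto simp: N instances_def)
qed

end
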